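(* Let $k \geq 1$ be an integer and let $G$ be a connected graph of order $n\ge 3$ and leaf order $\ell$. Then $\iota_k(G) = \frac{n-\ell}{2}$ if and only if $G$ is obtained in one of the following ways: (a) by attaching a positive number of leaves to each vertex of $K_2$, with at least $k-1$ leaves attached to one of them; (b) by attaching at least $k$ leaves to each vertex of a $4$-cycle; (c) by attaching a non-negative number of leaves to each vertex of some $G' \in \mathcal{G}'$ in such a way that at least $k$ leaves are attached to each leaf of $G'$.
   Context: Graphs are finite and simple. A leaf is a vertex of degree $1$; the leaf order is the number of leaves; the order is the number of vertices. Attaching a leaf to a vertex $v$ means adding a new vertex adjacent only to $v$. For $D\subseteq V(G)$, $N[D]$ is the set consisting of the vertices of $D$ and all their neighbours. For $k\ge 1$, a $k$-isolating set of $G$ is a set $D\subseteq V(G)$ (possibly empty) such that $G-N[D]$ contains no subgraph isomorphic to $K_{1,k}$ (equivalently, the maximum degree of $G-N[D]$ is at most $k-1$). The $k$-isolation number $\iota_k(G)$ is the size of a smallest $k$-isolating set of $G$. $\mathcal{G}'$ is the family of graphs obtained by attaching exactly one leaf to every vertex of a connected graph $H$ of order at least $2$ (the corona product of $H$ and $K_1$). *)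

theory Defs
  imports "Graph_Theory.Graph_Theory"
begin

text \<open>
  Finite simple graphs are the \<^locale>\<open>pair_graph\<close>s of the library: finite, loop-free, symmetric
  digraphs whose arcs are pairs, so that an edge $uv$ is the pair of arcs $(u,v)$, $(v,u)$. In
  particular, the degree of a vertex is its \<^const>\<open>out_degree\<close>.
\<close>

definition leaves :: "'a pair_pre_digraph \<Rightarrow> 'a set" where
  "leaves G = {v \<in> pverts G. out_degree (with_proj G) v = 1}"

definition closed_nbhd :: "'a pair_pre_digraph \<Rightarrow> 'a set \<Rightarrow> 'a set" where
  "closed_nbhd G D = D \<union> {w. \<exists>u\<in>D. (u, w) \<in> parcs G}"

definition isolating_set :: "nat \<Rightarrow> 'a pair_pre_digraph \<Rightarrow> 'a set \<Rightarrow> bool" where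
  "isolating_set k G D \<longleftrightarrow> D \<subseteq> pverts G \<and>
     \<not> (\<exists>S. subgraph S (induce_subgraph (with_proj G) (pverts G - closed_nbhd G D))
          \<and> complete_bipartite_digraph 1 k S)"

definition isolation_number :: "nat \<Rightarrow> 'a pair_pre_digraph \<Rightarrow> nat" where
  "isolation_number k G = (LEAST m. \<exists>D. isolating_set k G D \<and> card D = m)"

text \<open>
  Attaching all the leaves at once: \<open>L\<close> is the set of new vertices, and the new vertex \<open>x\<close> is made
  adjacent to \<open>p x\<close> only.
\<close>

definition attach_leaves :: "'a pair_pre_digraph \<Rightarrow> 'a set \<Rightarrow> ('a \<Rightarrow> 'a) \<Rightarrow> 'a pair_pre_digraph" where
  "attach_leaves H L p =
     \<lparr> pverts = pverts H \<union> L, parcs = parcs H \<union> (\<Union>x\<in>L. {(x, p x), (p x, x)}) \<rparr>"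

text \<open>
  \<open>G\<close> arises from \<open>H\<close> by attaching exactly \<open>f v\<close> leaves to each vertex \<open>v\<close> of \<open>H\<close>. No isomorphism
  is needed here, because \<open>H\<close> then is literally a subgraph of \<open>G\<close>; existentially quantifying over
  \<open>H\<close> makes the notion invariant under isomorphism of \<open>G\<close>.
\<close>

definition leaf_attachment :: "'a pair_pre_digraph \<Rightarrow> ('a \<Rightarrow> nat) \<Rightarrow> 'a pair_pre_digraph \<Rightarrow> bool" where
  "leaf_attachment H f G \<longleftrightarrow>
     (\<exists>L p. finite L \<and> L \<inter> pverts H = {} \<and> p ` L \<subseteq> pverts H
        \<and> (\<forall>v\<in>pverts H. card {x \<in> L. p x = v} = f v)
        \<and> G = attach_leaves H L p)"

definition cycle_graph :: "nat \<Rightarrow> 'a pair_pre_digraph \<Rightarrow> bool" where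
  "cycle_graph n H \<longleftrightarrow> n \<ge> 3 \<and>
     (\<exists>c. bij_betw c {..<n} (pverts H)
        \<and> parcs H = (\<Union>i<n. {(c i, c (Suc i mod n)), (c (Suc i mod n), c i)}))"

text \<open>The family $\mathcal{G}'$.\<close>

definition K1_coronas :: "'a pair_pre_digraph set" where
  "K1_coronas =
     {G'. \<exists>H. pair_graph H \<and> Digraph_Component.connected (with_proj H) \<and> card (pverts H) \<ge> 2
            \<and> leaf_attachment H (\<lambda>_. 1) G'}"

end

theory Submission
  imports Defs
begin

text \<open>
  Let \<open>H\<close> be the graph that remains of \<open>G\<close> without its leaves, of order $n-\ell$. A set that
  dominates \<open>H\<close> leaves only leaves of \<open>G\<close>, which are pairwise nonadjacent, so it is \<open>k\<close>-isolating in
  \<open>G\<close>. If \<open>H\<close> has at least two vertices, Ore's bound $\gamma(H)\le|H|/2$ therefore yields $\iota_k(G)\le(n-\ell)/2$, and equality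
  forces $\gamma(H)=|H|/2$. (If \<open>H\<close> has only one vertex, $(n-\ell)/2$ is not an integer.) The
  connected graphs with $\gamma=|H|/2$ are the 4-cycle and the coronas of connected graphs, $K_2$ being
  the corona of a single vertex (\<open>payan_xuong\<close>). So \<open>H\<close> is of one of the three kinds in the theorem.

  What remains is to find out, for each kind, how many leaves of \<open>G\<close> must hang at the vertices of \<open>H\<close>.
  Two observations settle it. A vertex of \<open>H\<close> with fewer than \<open>k\<close> leaves need not be dominated if its
  neighbours in \<open>H\<close> are (\<open>isolating_setI\<close>), which often saves a vertex. The closed neighbourhood
  of a vertex with at least \<open>k\<close> leaves meets every isolating set (\<open>isolating_set_meets\<close>), which gives
  lower bounds.

  Ore's bound and its extremal graphs both come from a maximum matching
  (\<open>small_dominating_set_or_perfect_matching\<close>): unless it is perfect, suitable ends of its edges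
  are a dominating set with fewer than half of the vertices. If it is perfect, and no
  dominating set is smaller than half, then a few matching edges can never be dominated by fewer
  vertices than there are edges. This determines how
  matching edges can be joined (\<open>perfect_matching_square\<close>).
\<close>

section \<open>Adjacency and connectivity\<close>

lemma pair_graphI:
  assumes "finite (pverts G)" "\<And>u v. (u, v) \<in> parcs G \<Longrightarrow> u \<in> pverts G \<and> u \<noteq> v \<and> (v, u) \<in> parcs G"
  shows "pair_graph G"
proof -
  have sub: "parcs G \<subseteq> pverts G \<times> pverts G" using assms(2) by auto
  have fin: "finite (parcs G)" using finite_subset[OF sub] assms(1) by blast
  show ?thesis
    using assms sub fin by unfold_locales (auto simp: symmetric_def intro!: symI)
qed

context pair_graph
begin

lemma adj_sym: "(u, v) \<in> parcs G \<longleftrightarrow> (v, u) \<in> parcs G"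
  using arcs_symmetric by blast

lemma finite_nbrs [simp]: "finite {w. (v, w) \<in> parcs G}"
  by (rule finite_subset[OF _ pair_finite_verts]) (auto dest: in_arcsD2)

lemma out_degree_eq: "out_degree (with_proj G) v = card {w. (v, w) \<in> parcs G}"
proof -
  have "out_arcs (with_proj G) v = Pair v ` {w. (v, w) \<in> parcs G}" by (auto simp: out_arcs_def)
  then show ?thesis unfolding out_degree_def by (simp add: card_image inj_on_def)
qed

lemma mk_symmetric_self: "mk_symmetric (with_proj G) = G"
proof -
  have "(\<Union>e\<in>parcs G. {(fst e, snd e), (snd e, fst e)}) = parcs G"
    using arcs_symmetric by auto
  then show ?thesis by (simp add: mk_symmetric_def)
qed

text \<open>
  The vertices reachable from a given one form a set that no arc leaves. Cuts, unlike walks, are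
  easily transferred between a graph and the graph without its pendant vertices.
\<close>

lemma connected_iff_cut:
  "Digraph_Component.connected (with_proj G) \<longleftrightarrow> pverts G \<noteq> {} \<and>
     (\<forall>S \<subseteq> pverts G. S \<noteq> {} \<longrightarrow> S \<noteq> pverts G \<longrightarrow> (\<exists>u\<in>S. \<exists>v\<in>pverts G - S. (u, v) \<in> parcs G))"
  (is "?L \<longleftrightarrow> ?R")
proof
  assume L: ?L
  then have sc: "strongly_connected (with_proj G)"
    by (simp add: Digraph_Component.connected_def mk_symmetric_self)
  show ?R
  proof (intro conjI allI impI)
    show "pverts G \<noteq> {}" using sc by (auto simp: strongly_connected_def)
  next
    fix S assume S: "S \<subseteq> pverts G" "S \<noteq> {}" "S \<noteq> pverts G"
    then obtain u v where u: "u \<in> S" and v: "v \<in> pverts G - S" by blast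
    then have "u \<rightarrow>\<^sup>*\<^bsub>with_proj G\<^esub> v" using sc S by (auto simp: strongly_connected_def)
    then have "v \<in> S" if "\<not> (\<exists>u\<in>S. \<exists>v\<in>pverts G - S. (u, v) \<in> parcs G)"
    proof (induction rule: reachable_induct)
      case base then show ?case using u by simp
    next
      case (step x y)
      then show ?case using that in_arcsD2 by auto
    qed
    then show "\<exists>u\<in>S. \<exists>v\<in>pverts G - S. (u, v) \<in> parcs G" using v by blast
  qed
next
  assume R: ?R
  have "u \<rightarrow>\<^sup>*\<^bsub>with_proj G\<^esub> v" if uv: "u \<in> pverts G" "v \<in> pverts G" for u v
  proof -
    let ?S = "{w. u \<rightarrow>\<^sup>*\<^bsub>with_proj G\<^esub> w}"
    have sub: "?S \<subseteq> pverts G" using reachable_in_verts by auto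
    have u: "u \<in> ?S" using uv by simp
    have closed: "\<not> (\<exists>x\<in>?S. \<exists>y\<in>pverts G - ?S. (x, y) \<in> parcs G)"
      using reachable_adj_trans by auto
    have "?S = pverts G" using R sub u closed by blast
    then show ?thesis using uv by blast
  qed
  then have "strongly_connected (with_proj G)" using R by (intro strongly_connectedI) auto
  then show ?L
    by (simp add: Digraph_Component.connected_def mk_symmetric_self)
qed

lemma connected_imp_no_isolated:
  assumes "Digraph_Component.connected (with_proj G)" "card (pverts G) \<ge> 2" "v \<in> pverts G"
  obtains w where "(v, w) \<in> parcs G"
proof -
  have "{v} \<noteq> pverts G"
  proof
    assume "{v} = pverts G"
    then have "card (pverts G) = card {v}" by simp
    then show False using assms(2) by simp
  qed
  then show thesis using assms that unfolding connected_iff_cut by (metis empty_not_insert empty_subsetI insert_subset singletonD)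
qed

end

definition induced :: "'a pair_pre_digraph \<Rightarrow> 'a set \<Rightarrow> 'a pair_pre_digraph" where
  "induced G S = \<lparr> pverts = S, parcs = parcs G \<inter> S \<times> S \<rparr>"

lemma induced_simps [simp]: "pverts (induced G S) = S" "parcs (induced G S) = parcs G \<inter> S \<times> S"
  by (simp_all add: induced_def)

lemma (in pair_graph) pair_graph_induced: "S \<subseteq> pverts G \<Longrightarrow> pair_graph (induced G S)"
  using no_loops' arcs_symmetric finite_subset[OF _ pair_finite_verts]
  by (intro pair_graphI) auto

text \<open>
  A cut of the smaller graph extends to a cut of \<open>G\<close> by putting every deleted vertex on the side of
  its only neighbour; the edge that crosses the extended cut cannot be pendant, so it crosses the
  original one.
\<close>

lemma (in pair_graph) connected_remove_pendants:
  assumes con: "Digraph_Component.connected (with_proj G)"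
    and B: "B \<subseteq> pverts G" "B \<noteq> {}"
    and p: "\<And>x w. x \<in> pverts G - B \<Longrightarrow> (x, w) \<in> parcs G \<Longrightarrow> w = p x"
      "p ` (pverts G - B) \<subseteq> B"
  shows "Digraph_Component.connected (with_proj (induced G B))"
proof -
  interpret I: pair_graph "induced G B" by (rule pair_graph_induced[OF B(1)])
  have "\<exists>u\<in>S. \<exists>v\<in>B - S. (u, v) \<in> parcs G" if S: "S \<subseteq> B" "S \<noteq> {}" "S \<noteq> B" for S
  proof -
    let ?T = "S \<union> {x \<in> pverts G - B. p x \<in> S}"
    have "?T \<subseteq> pverts G" "?T \<noteq> {}" "?T \<noteq> pverts G" using S B by auto
    then obtain u v where uv: "u \<in> ?T" "v \<in> pverts G - ?T" "(u, v) \<in> parcs G"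
      using con unfolding connected_iff_cut by meson
    have u: "u \<in> S" using uv p by auto
    have "v \<in> B" using uv p(1)[of v u] adj_sym u by auto
    then show ?thesis using u uv by auto
  qed
  then show ?thesis unfolding I.connected_iff_cut induced_simps using B(2) by blast
qed

section \<open>Isolating sets\<close>

lemma closed_nbhd_empty [simp]: "closed_nbhd G {} = {}" by (simp add: closed_nbhd_def)

lemma subset_closed_nbhd: "D \<subseteq> closed_nbhd G D" by (simp add: closed_nbhd_def)

text \<open>
  Being isolating is a degree condition: a vertex with \<open>k\<close> neighbours left is the centre of a
  $K_{1,k}$.
\<close>

lemma (in pair_graph) isolating_set_iff:
  "isolating_set k G D \<longleftrightarrow> D \<subseteq> pverts G \<and>
    (\<forall>v \<in> pverts G - closed_nbhd G D. card {w \<in> pverts G - closed_nbhd G D. (v, w) \<in> parcs G} < k)"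
proof -
  let ?R = "pverts G - closed_nbhd G D"
  let ?I = "induce_subgraph (with_proj G) ?R"
  have I: "verts ?I = ?R" "arcs ?I = parcs G \<inter> ?R \<times> ?R" "tail ?I = fst" "head ?I = snd"
    by (auto simp: induce_subgraph_def)
  have "(\<exists>S. subgraph S ?I \<and> complete_bipartite_digraph 1 k S) \<longleftrightarrow>
    (\<exists>v \<in> ?R. k \<le> card {w \<in> ?R. (v, w) \<in> parcs G})"
  proof
    assume "\<exists>S. subgraph S ?I \<and> complete_bipartite_digraph 1 k S"
    then obtain S U W where S: "subgraph S ?I" "verts S = U \<union> W" "card U = 1" "card W = k"
      "arcs_ends S = U \<times> W \<union> W \<times> U"
      unfolding complete_bipartite_digraph_def by blast
    then obtain v where v: "U = {v}" by (auto simp: card_1_singleton_iff)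
    have "arcs_ends S = arcs S" using S(1) I by (auto simp: subgraph_def compatible_def arcs_ends_conv)
    then have "W \<subseteq> {w \<in> ?R. (v, w) \<in> parcs G}" "v \<in> ?R"
      using S v I by (auto simp: subgraph_def)
    then show "\<exists>v \<in> ?R. k \<le> card {w \<in> ?R. (v, w) \<in> parcs G}"
      using S(4) card_mono[of "{w \<in> ?R. (v, w) \<in> parcs G}" W] pair_finite_verts by auto
  next
    assume "\<exists>v \<in> ?R. k \<le> card {w \<in> ?R. (v, w) \<in> parcs G}"
    then obtain v W where v: "v \<in> ?R" and W: "W \<subseteq> {w \<in> ?R. (v, w) \<in> parcs G}" "card W = k"
      by (meson obtain_subset_with_card_n)
    have fW: "finite W" using W(1) pair_finite_verts by (auto intro: finite_subset)
    have vW: "v \<notin> W" using W no_loops' by auto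
    let ?S = "\<lparr> pverts = {v} \<union> W, parcs = {v} \<times> W \<union> W \<times> {v} \<rparr>"
    have K: "complete_bipartite_digraph 1 k (with_proj ?S)"
      unfolding complete_bipartite_digraph_pair_def
      using fW vW W(2) by (intro conjI exI[of _ "{v}"] exI[of _ W]) auto
    interpret S: pair_graph ?S using K by (rule pair_graphI_complete_bipartite)
    have "wf_digraph ?I" by (rule wellformed_induce_subgraph)
    then have "subgraph (with_proj ?S) ?I"
      using v W adj_sym S.wf_digraph by (auto simp: subgraph_def I compatible_def)
    then show "\<exists>S. subgraph S ?I \<and> complete_bipartite_digraph 1 k S" using K by blast
  qed
  then show ?thesis unfolding isolating_set_def by (auto simp: not_le)
qed

lemma isolation_number_le: "isolating_set k G D \<Longrightarrow> isolation_number k G \<le> card D"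
  unfolding isolation_number_def by (rule Least_le) blast

lemma (in pair_graph) isolation_number_attained:
  obtains D where "isolating_set k G D" "card D = isolation_number k G"
proof -
  have "isolating_set k G (pverts G)"
    unfolding isolating_set_iff using subset_closed_nbhd[of "pverts G" G] by auto
  then have "\<exists>m D. isolating_set k G D \<and> card D = m" by blast
  from LeastI_ex[OF this] show thesis using that unfolding isolation_number_def by blast
qed

section \<open>Domination and matchings\<close>

definition dominating_set :: "'a pair_pre_digraph \<Rightarrow> 'a set \<Rightarrow> bool" where
  "dominating_set G D \<longleftrightarrow> D \<subseteq> pverts G \<and> pverts G \<subseteq> closed_nbhd G D"

text \<open>
  A perfect matching is given by the involution \<open>g\<close> that swaps the ends of each edge, so that both
  ends can be treated alike, together with a set \<open>A\<close> of one end of each edge, for counting.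
\<close>

definition perfect_matching :: "'a pair_pre_digraph \<Rightarrow> 'a set \<Rightarrow> ('a \<Rightarrow> 'a) \<Rightarrow> bool" where
  "perfect_matching G A g \<longleftrightarrow> A \<subseteq> pverts G \<and> g ` A = pverts G - A \<and>
     (\<forall>x\<in>pverts G. g (g x) = x \<and> (x, g x) \<in> parcs G)"

context pair_graph
begin

lemma maximum_matching:
  obtains A f where "A \<subseteq> pverts G" "inj_on f A" "f ` A \<subseteq> pverts G - A" "\<And>a. a \<in> A \<Longrightarrow> (a, f a) \<in> parcs G"
    and "\<And>A' f'. A' \<subseteq> pverts G \<Longrightarrow> inj_on f' A' \<Longrightarrow> f' ` A' \<subseteq> pverts G - A' \<Longrightarrow>
       (\<And>a. a \<in> A' \<Longrightarrow> (a, f' a) \<in> parcs G) \<Longrightarrow> card A' \<le> card A"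
proof -
  define M where "M = (\<lambda>(A, f). A \<subseteq> pverts G \<and> inj_on f A \<and> f ` A \<subseteq> pverts G - A \<and> (\<forall>a\<in>A. (a, f a) \<in> parcs G))"
  have "M ({}, id)" by (simp add: M_def)
  moreover have "\<forall>m. M m \<longrightarrow> card (fst m) < Suc (card (pverts G))"
    by (auto simp: M_def less_Suc_eq_le card_mono pair_finite_verts)
  ultimately obtain m where m: "M m" "\<forall>m'. M m' \<longrightarrow> card (fst m') \<le> card (fst m)"
    using ex_has_greatest_nat[of M _ "\<lambda>m. card (fst m)"] by blast
  obtain A f where "m = (A, f)" by (cases m)
  with m have Af: "M (A, f)" and max: "\<And>A' f'. M (A', f') \<Longrightarrow> card A' \<le> card A" by auto
  show thesis
  proof (rule that[of A f])
    fix A' f'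
    assume "A' \<subseteq> pverts G" "inj_on f' A'" "f' ` A' \<subseteq> pverts G - A'" "\<And>a. a \<in> A' \<Longrightarrow> (a, f' a) \<in> parcs G"
    then show "card A' \<le> card A" by (intro max[of A' f']) (auto simp: M_def)
  qed (use Af in \<open>auto simp: M_def\<close>)
qed

text \<open>
  Take a maximum matching. The unmatched vertices form an independent set \<open>U\<close>, and the two ends
  of a matching edge cannot have different neighbours in \<open>U\<close>, as that would give an augmenting path. So one end of
  each edge suffices to dominate everything, namely the end with a neighbour in \<open>U\<close> if there is one.
  These are $(|V|-|U|)/2$ vertices, which is less than half unless \<open>U\<close> is empty.
\<close>

lemma small_dominating_set_or_perfect_matching:
  assumes no_isolated: "\<And>v. v \<in> pverts G \<Longrightarrow> \<exists>w. (v, w) \<in> parcs G"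
  shows "(\<exists>D. dominating_set G D \<and> 2 * card D < card (pverts G)) \<or> (\<exists>A g. perfect_matching G A g)"
proof -
  obtain A f where A: "A \<subseteq> pverts G" "inj_on f A" "f ` A \<subseteq> pverts G - A"
    "\<And>a. a \<in> A \<Longrightarrow> (a, f a) \<in> parcs G"
    and max: "\<And>A' f'. A' \<subseteq> pverts G \<Longrightarrow> inj_on f' A' \<Longrightarrow> f' ` A' \<subseteq> pverts G - A' \<Longrightarrow>
       (\<And>a. a \<in> A' \<Longrightarrow> (a, f' a) \<in> parcs G) \<Longrightarrow> card A' \<le> card A"
    by (rule maximum_matching) blast
  have fA: "finite A" using A(1) finite_subset pair_finite_verts by blast
  define U where "U = pverts G - A - f ` A"
  have "pverts G = (A \<union> f ` A) \<union> U" using A(1,3) U_def by blast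
  also have "card \<dots> = card (A \<union> f ` A) + card U"
    using fA pair_finite_verts by (intro card_Un_disjoint) (auto simp: U_def)
  finally have "card (pverts G) = card (A \<union> f ` A) + card U" .
  moreover have "card (A \<union> f ` A) = card A + card (f ` A)"
    using A(3) fA by (intro card_Un_disjoint) auto
  ultimately have card_V: "card (pverts G) = 2 * card A + card U"
    using A(2) by (simp add: card_image)
  have indep: False if "u \<in> U" "w \<in> U" "(u, w) \<in> parcs G" for u w
  proof -
    have "card (insert u A) \<le> card A"
    proof (rule max)
      show "inj_on (f(u := w)) (insert u A)"
        using that A(2) by (auto simp: U_def inj_on_def)
      show "(f(u := w)) ` insert u A \<subseteq> pverts G - insert u A"
        using that A(3) no_loops' by (auto simp: U_def)
    qed (use that A in \<open>auto simp: U_def\<close>)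
    then show False using that fA by (simp add: U_def)
  qed
  have augment: "u = u'" if "a \<in> A" "u \<in> U" "u' \<in> U" "(a, u) \<in> parcs G" "(f a, u') \<in> parcs G" for a u u'
  proof (rule ccontr)
    assume ne: "u \<noteq> u'"
    \<comment> \<open>The path \<open>u\<close>, \<open>a\<close>, \<open>f a\<close>, \<open>u'\<close> is augmenting.\<close>
    let ?f = "f(a := u, u' := f a)"
    have au: "a \<noteq> u'" using that by (auto simp: U_def)
    have old: "?f x = f x" if "x \<in> A" "x \<noteq> a" for x using that \<open>u' \<in> U\<close> by (auto simp: U_def)
    have new: "?f a = u" "?f u' = f a" using au by auto
    have "card (insert u' A) \<le> card A"
    proof (rule max)
      show "inj_on ?f (insert u' A)"
        using that A(2) ne by (auto simp: U_def inj_on_def)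
      show "?f ` insert u' A \<subseteq> pverts G - insert u' A"
        using that A(3) ne by (auto simp: U_def)
      show "(x, ?f x) \<in> parcs G" if x: "x \<in> insert u' A" for x
        using \<open>(a, u) \<in> parcs G\<close> \<open>(f a, u') \<in> parcs G\<close> arcs_symmetric A(4) x by auto
    qed (use that A in \<open>auto simp: U_def\<close>)
    then show False using that fA by (simp add: U_def)
  qed
  define c where "c = (\<lambda>a. if \<exists>u\<in>U. (a, u) \<in> parcs G then a else f a)"
  have "dominating_set G (c ` A)" unfolding dominating_set_def
  proof (intro conjI subsetI)
    fix x assume "x \<in> c ` A" then show "x \<in> pverts G" using A by (auto simp: c_def)
  next
    fix x assume x: "x \<in> pverts G"
    have matched: "a \<in> closed_nbhd G (c ` A)" "f a \<in> closed_nbhd G (c ` A)" if "a \<in> A" for a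
    proof -
      have "c a \<in> c ` A" "c a = a \<or> c a = f a" using that by (auto simp: c_def)
      then show "a \<in> closed_nbhd G (c ` A)" "f a \<in> closed_nbhd G (c ` A)"
        using A(4)[OF that] arcs_symmetric by (auto simp: closed_nbhd_def) metis+
    qed
    show "x \<in> closed_nbhd G (c ` A)"
    proof (cases "x \<in> U")
      case False
      then show ?thesis using x matched by (auto simp: U_def)
    next
      case True
      obtain w where w: "(x, w) \<in> parcs G" using no_isolated x by blast
      then have "w \<notin> U" using indep True by blast
      then obtain a where a: "a \<in> A" "w = a \<or> w = f a" using w in_arcsD2 by (auto simp: U_def)
      have "(c a, x) \<in> parcs G"
      proof (cases "\<exists>u\<in>U. (a, u) \<in> parcs G")
        case True
        then show ?thesis
          using a w adj_sym augment[of a _ x] \<open>x \<in> U\<close> by (auto simp: c_def)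
      next
        case False
        then show ?thesis using a w adj_sym \<open>x \<in> U\<close> by (auto simp: c_def)
      qed
      then show ?thesis using a by (auto simp: closed_nbhd_def)
    qed
  qed
  moreover have "card (c ` A) \<le> card A" using fA by (rule card_image_le)
  moreover have "\<exists>g. perfect_matching G A g" if "U = {}"
  proof -
    define g where "g = (\<lambda>x. if x \<in> A then f x else inv_into A f x)"
    have fA': "f ` A = pverts G - A" using that A by (auto simp: U_def)
    have "g (g x) = x \<and> (x, g x) \<in> parcs G" if x: "x \<in> pverts G" for x
    proof (cases "x \<in> A")
      case True
      then show ?thesis using fA' A by (auto simp: g_def)
    next
      case False
      then have "x \<in> f ` A" using x fA' by simp
      then have "inv_into A f x \<in> A" "f (inv_into A f x) = x"
        by (auto simp: inv_into_into f_inv_into_f)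
      then show ?thesis using False A(4)[of "inv_into A f x"] arcs_symmetric by (auto simp: g_def)
    qed
    moreover have "g ` A = f ` A" by (auto simp: g_def)
    ultimately show ?thesis using fA' A(1) by (auto simp: perfect_matching_def)
  qed
  moreover have "card U > 0" if "U \<noteq> {}"
    using that pair_finite_verts by (auto simp: U_def card_gt_0_iff)
  ultimately show ?thesis
  proof (cases "U = {}")
    case False
    then have "2 * card (c ` A) < card (pverts G)"
      using card_V \<open>card (c ` A) \<le> card A\<close> \<open>U \<noteq> {} \<Longrightarrow> card U > 0\<close> by simp
    then show ?thesis using \<open>dominating_set G (c ` A)\<close> by blast
  qed blast
qed

text \<open>
  A set closed under \<open>g\<close> is a union of matching edges; half of its vertices, one from each edge, lie
  in \<open>A\<close> and dominate it.
\<close>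

lemma perfect_matching_card:
  assumes "perfect_matching G A g" "W \<subseteq> pverts G" "g ` W \<subseteq> W"
  shows "W = (A \<inter> W) \<union> g ` (A \<inter> W)" "card W = 2 * card (A \<inter> W)"
proof -
  have inv: "g (g x) = x" if "x \<in> pverts G" for x using assms that by (simp add: perfect_matching_def)
  have A: "A \<subseteq> pverts G" "g ` A = pverts G - A" using assms by (auto simp: perfect_matching_def)
  have "x \<in> g ` (A \<inter> W)" if "x \<in> W" "x \<notin> A" for x
  proof -
    have "x \<in> g ` A" using A(2) assms(2) that by auto
    then obtain a where a: "a \<in> A" "x = g a" by blast
    then have "g x = a" using A(1) inv by auto
    then have "a \<in> W" using assms(3) \<open>x \<in> W\<close> by auto
    then show ?thesis using a by auto
  qed
  then show W: "W = (A \<inter> W) \<union> g ` (A \<inter> W)" using assms(3) by blast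
  have "inj_on g (A \<inter> W)" 
  proof (rule inj_onI)
    fix u v assume "u \<in> A \<inter> W" "v \<in> A \<inter> W" "g u = g v"
    then show "u = v" using inv[of u] inv[of v] assms(2) by auto
  qed
  moreover have "finite W" using assms finite_subset pair_finite_verts by blast
  moreover have "(A \<inter> W) \<inter> g ` (A \<inter> W) = {}" using A by blast
  ultimately have "card ((A \<inter> W) \<union> g ` (A \<inter> W)) = 2 * card (A \<inter> W)"
    by (subst card_Un_disjoint) (auto simp: card_image)
  then show "card W = 2 * card (A \<inter> W)" using W by simp
qed

lemma ore_domination_bound:
  assumes "\<And>v. v \<in> pverts G \<Longrightarrow> \<exists>w. (v, w) \<in> parcs G"
  obtains D where "dominating_set G D" "2 * card D \<le> card (pverts G)"
proof -
  have "\<exists>D. dominating_set G D \<and> 2 * card D \<le> card (pverts G)" if pm: "perfect_matching G A g" for A g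
  proof -
    have g: "g ` pverts G \<subseteq> pverts G" "A \<subseteq> pverts G" "A \<inter> pverts G = A"
      using pm in_arcsD2 by (fastforce simp: perfect_matching_def)+
    have "(a, g a) \<in> parcs G" if "a \<in> A" for a using pm that by (auto simp: perfect_matching_def)
    then have "dominating_set G A"
      using perfect_matching_card(1)[OF pm _ g(1)] g by (auto simp: dominating_set_def closed_nbhd_def)
    then show ?thesis using perfect_matching_card(2)[OF pm _ g(1)] g by (intro exI[of _ A]) simp
  qed
  then show thesis
    using that small_dominating_set_or_perfect_matching[OF assms] less_imp_le by blast
qed

text \<open>
  If half of the vertices are needed to dominate, then a union \<open>W\<close> of matching edges cannot be
  dominated by fewer than half of its own number of vertices, since one end of each remaining
  edge completes any such set to a dominating set of \<open>G\<close>.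
\<close>

lemma perfect_matching_exchange:
  assumes pm: "perfect_matching G A g"
    and min: "\<And>D. dominating_set G D \<Longrightarrow> card (pverts G) \<le> 2 * card D"
    and W: "W \<subseteq> pverts G" "g ` W \<subseteq> W" and Y: "Y \<subseteq> pverts G" "W \<subseteq> closed_nbhd G Y"
  shows "card W \<le> 2 * card Y"
proof -
  have arc: "(x, g x) \<in> parcs G" if "x \<in> pverts G" for x using pm that by (simp add: perfect_matching_def)
  have inv: "g (g x) = x" if "x \<in> pverts G" for x using pm that by (simp add: perfect_matching_def)
  let ?R = "pverts G - W"
  have R: "g ` ?R \<subseteq> ?R"
  proof
    fix y assume "y \<in> g ` ?R"
    then obtain x where "x \<in> ?R" "y = g x" by blast
    then show "y \<in> ?R" using arc[of x] inv[of x] in_arcsD2 W(2) by auto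
  qed
  note RA = perfect_matching_card[OF pm _ R]
  have "dominating_set G (Y \<union> (A \<inter> ?R))" unfolding dominating_set_def
  proof (intro conjI subsetI)
    fix x assume x: "x \<in> pverts G"
    show "x \<in> closed_nbhd G (Y \<union> (A \<inter> ?R))"
    proof (cases "x \<in> W")
      case True
      then show ?thesis using Y by (auto simp: closed_nbhd_def)
    next
      case False
      then have "x \<in> (A \<inter> ?R) \<union> g ` (A \<inter> ?R)" using RA(1) x by auto
      then show ?thesis using arc by (auto simp: closed_nbhd_def)
    qed
  qed (use Y in auto)
  then have "card (pverts G) \<le> 2 * card (Y \<union> (A \<inter> ?R))" by (rule min)
  also have "\<dots> \<le> 2 * card Y + card ?R" using card_Un_le[of Y "A \<inter> ?R"] RA(2) by simp
  also have "card ?R = card (pverts G) - card W"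
    using W finite_subset pair_finite_verts by (metis card_Diff_subset)
  finally show ?thesis using card_mono[OF pair_finite_verts W(1)] by simp
qed

text \<open>
  The local structure of the extremal graphs. If both ends of the matching edge of \<open>x\<close> have a further
  neighbour, \<open>y\<close> and \<open>z\<close> say, then \<open>{y, z}\<close> dominates the matching edges of \<open>x\<close>, \<open>y\<close> and
  \<open>z\<close>. This is too cheap both when these are three edges and when \<open>y = z\<close>; so \<open>y\<close> and \<open>z\<close> are the two
  ends of one edge.
\<close>

lemma perfect_matching_square:
  assumes pm: "perfect_matching G A g"
    and min: "\<And>D. dominating_set G D \<Longrightarrow> card (pverts G) \<le> 2 * card D"
    and x: "x \<in> pverts G" "(x, y) \<in> parcs G" "y \<noteq> g x" "(g x, z) \<in> parcs G" "z \<noteq> x"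
  shows "z = g y"
proof (rule ccontr)
  assume zy: "z \<noteq> g y"
  have V: "g x \<in> pverts G" "y \<in> pverts G" "z \<in> pverts G" using x in_arcsD1 in_arcsD2 by auto
  have arc: "(v, g v) \<in> parcs G" and inv: "g (g v) = v" if "v \<in> pverts G" for v
    using pm that by (auto simp: perfect_matching_def)
  have V': "g y \<in> pverts G" "g z \<in> pverts G" using V arc in_arcsD2 by blast+
  have ne: "v \<noteq> g v" if "v \<in> pverts G" for v using arc[OF that] no_loops' by blast
  have xy: "x \<noteq> y" "z \<noteq> g x" using x no_loops' by auto
  let ?W = "{x, g x} \<union> {y, g y} \<union> {z, g z}"
  have "card ?W \<le> 2 * card {y, z}"
  proof (rule perfect_matching_exchange[OF pm min])
    show "?W \<subseteq> pverts G" using x V V' by auto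
    show "g ` ?W \<subseteq> ?W" using x V inv by auto
    show "{y, z} \<subseteq> pverts G" using V by auto
    show "?W \<subseteq> closed_nbhd G {y, z}"
      using x arc V adj_sym by (auto simp: closed_nbhd_def)
  qed
  moreover have apart: "u \<noteq> v \<and> u \<noteq> g v \<and> g u \<noteq> v \<and> g u \<noteq> g v"
    if "u \<in> pverts G" "v \<in> pverts G" "u \<noteq> v" "u \<noteq> g v" for u v
    using that inv by metis
  moreover have "card {x, g x, y, g y} = 4"
    using ne[OF x(1)] ne[OF V(2)] apart[of x y] apart[of y x] xy x V by auto
  moreover have "card {x, g x, y, g y, z, g z} = 6" if "y \<noteq> z"
    using that ne[OF x(1)] ne[OF V(2)] ne[OF V(3)] apart[of x y] apart[of y x] apart[of x z]
      apart[of z x] apart[of y z] apart[of z y] xy zy x V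
    by auto
  ultimately show False by (cases "y = z") (auto simp: insert_commute)
qed

end

section \<open>Graphs whose domination number is half their order\<close>

lemma cycle_graph_4_iff:
  "cycle_graph 4 H \<longleftrightarrow> (\<exists>a b c d. distinct [a, b, c, d] \<and> pverts H = {a, b, c, d} \<and>
     parcs H = {(a, b), (b, a), (b, c), (c, b), (c, d), (d, c), (d, a), (a, d)})"
proof -
  have 4: "{..<4::nat} = {0, 1, 2, 3}" by auto
  show ?thesis
  proof
    assume "cycle_graph 4 H"
    then obtain c where c: "bij_betw c {..<4::nat} (pverts H)"
      "parcs H = (\<Union>i<4. {(c i, c (Suc i mod 4)), (c (Suc i mod 4), c i)})"
      by (auto simp: cycle_graph_def)
    have ne: "c i \<noteq> c j" if "i < 4" "j < 4" "i \<noteq> j" for i j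
      using that c(1) by (auto simp: bij_betw_def inj_on_def)
    have "distinct [c 0, c 1, c 2, c 3]" by (simp add: ne)
    moreover have "pverts H = {c 0, c 1, c 2, c 3}"
      using bij_betw_imp_surj_on[OF c(1)] unfolding 4 by simp
    moreover have "parcs H = {(c 0, c 1), (c 1, c 0), (c 1, c 2), (c 2, c 1),
        (c 2, c 3), (c 3, c 2), (c 3, c 0), (c 0, c 3)}"
      unfolding c(2) 4 by (simp add: insert_commute flip: numeral_2_eq_2)
    ultimately show "\<exists>a b c d. distinct [a, b, c, d] \<and> pverts H = {a, b, c, d} \<and>
     parcs H = {(a, b), (b, a), (b, c), (c, b), (c, d), (d, c), (d, a), (a, d)}" by blast
  next
    assume "\<exists>a b c d. distinct [a, b, c, d] \<and> pverts H = {a, b, c, d} \<and>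
     parcs H = {(a, b), (b, a), (b, c), (c, b), (c, d), (d, c), (d, a), (a, d)}"
    then obtain a b c d where H: "distinct [a, b, c, d]" "pverts H = {a, b, c, d}"
      "parcs H = {(a, b), (b, a), (b, c), (c, b), (c, d), (d, c), (d, a), (a, d)}" by blast
    have "bij_betw (\<lambda>i. [a, b, c, d] ! i) {..<4} (pverts H)"
      using H by (auto simp: 4 bij_betw_def inj_on_def)
    moreover have "parcs H = (\<Union>i<4. {([a, b, c, d] ! i, [a, b, c, d] ! (Suc i mod 4)),
        ([a, b, c, d] ! (Suc i mod 4), [a, b, c, d] ! i)})"
      unfolding H(3) 4 by (simp add: insert_commute flip: numeral_2_eq_2)
    ultimately show "cycle_graph 4 H"
      unfolding cycle_graph_def by (intro conjI exI[of _ "\<lambda>i. [a, b, c, d] ! i"]) auto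
  qed
qed

lemma (in pair_graph) attach_leaves_induced:
  assumes B: "B \<subseteq> pverts G"
    and p: "\<And>x w. x \<in> pverts G - B \<Longrightarrow> (x, w) \<in> parcs G \<longleftrightarrow> w = p x"
      "p ` (pverts G - B) \<subseteq> B"
  shows "G = attach_leaves (induced G B) (pverts G - B) p"
proof -
  have "parcs G = parcs G \<inter> B \<times> B \<union> (\<Union>x\<in>pverts G - B. {(x, p x), (p x, x)})" (is "_ = ?P")
  proof (rule set_eqI)
    fix e :: "'a \<times> 'a"
    obtain u v where e: "e = (u, v)" by (cases e)
    consider "u \<notin> pverts G \<or> v \<notin> pverts G" | "u \<in> B" "v \<in> B"
      | "u \<in> pverts G - B" "v \<in> pverts G" | "u \<in> B" "v \<in> pverts G - B" by blast
    then have "(u, v) \<in> parcs G \<longleftrightarrow> (u, v) \<in> ?P"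
    proof cases
      case 1
      then show ?thesis using in_arcsD1 in_arcsD2 B p(2) by auto
    next
      case 2
      then show ?thesis by auto
    next
      case 3
      then show ?thesis using p(1)[of u v] p(2) by auto
    next
      case 4
      then show ?thesis using p(1)[of v u] p(2) adj_sym[of u v] by auto
    qed
    then show "e \<in> parcs G \<longleftrightarrow> e \<in> ?P" using e by simp
  qed
  then show ?thesis using B by (auto simp: attach_leaves_def intro!: pair_pre_digraph.equality)
qed

text \<open>
  The theorem of Payan and Xuong, and of Fink, Jacobson, Kinch and Roberts: a connected graph whose
  domination number is half its order is a 4-cycle or the corona of a connected graph. By
  \<open>perfect_matching_square\<close>, a matching edge both of whose ends have further neighbours lies in a
  4-cycle with no edges leaving it, which then is the whole graph. Otherwise each matching edge has
  an end of degree 1, and the other ends form the graph of which \<open>G\<close> is the corona; here that graph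
  may be a single vertex.
\<close>

lemma (in pair_graph) payan_xuong:
  assumes con: "Digraph_Component.connected (with_proj G)" and two: "card (pverts G) \<ge> 2"
    and min: "\<And>D. dominating_set G D \<Longrightarrow> card (pverts G) \<le> 2 * card D"
  shows "cycle_graph 4 G \<or>
    (\<exists>H. pair_graph H \<and> Digraph_Component.connected (with_proj H) \<and> leaf_attachment H (\<lambda>_. 1) G)"
proof -
  have "\<exists>w. (v, w) \<in> parcs G" if "v \<in> pverts G" for v
    using connected_imp_no_isolated[OF con two that] by blast
  from small_dominating_set_or_perfect_matching[OF this] obtain A g where pm: "perfect_matching G A g"
    using min by fastforce
  have sq: "z = g y" if "x \<in> pverts G" "(x, y) \<in> parcs G" "y \<noteq> g x" "(g x, z) \<in> parcs G" "z \<noteq> x" for x y z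
    using perfect_matching_square[OF pm min] that by blast
  have A: "A \<subseteq> pverts G" "g ` A = pverts G - A" using pm by (auto simp: perfect_matching_def)
  have arc: "(v, g v) \<in> parcs G" and inv: "g (g v) = v" if "v \<in> pverts G" for v
    using pm that by (auto simp: perfect_matching_def)
  have gV: "g v \<in> pverts G" if "v \<in> pverts G" for v using arc that in_arcsD2 by blast
  have ne: "v \<noteq> g v" if "v \<in> pverts G" for v using arc[OF that] no_loops' by blast
  show ?thesis
  proof (cases "\<exists>x\<in>pverts G. (\<exists>y. (x, y) \<in> parcs G \<and> y \<noteq> g x) \<and> (\<exists>z. (g x, z) \<in> parcs G \<and> z \<noteq> x)")
    case True
    then obtain x y z where x: "x \<in> pverts G" and y: "(x, y) \<in> parcs G" "y \<noteq> g x"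
      and "(g x, z) \<in> parcs G" "z \<noteq> x" by blast
    then have gxgy: "(g x, g y) \<in> parcs G" and gyx: "g y \<noteq> x" using sq by blast+
    have yV: "y \<in> pverts G" using y in_arcsD2 by blast
    have xy: "x \<noteq> y" using y no_loops' by blast
    have gg: "g x \<noteq> g y" using xy x yV inv by metis
    \<comment> \<open>Starting from each corner of the square \<open>x\<close>, \<open>y\<close>, \<open>g y\<close>, \<open>g x\<close> in turn, \<open>sq\<close> excludes edges to
      the outside as well as diagonals.\<close>
    have nx: "w = g x \<or> w = y" if "(x, w) \<in> parcs G" for w
    proof -
      have "g w = g y" if "w \<noteq> g x" using sq[OF x \<open>(x, w) \<in> parcs G\<close> that gxgy gyx] by simp
      then show ?thesis using inv[of w] inv[OF yV] in_arcsD2[OF that] by metis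
    qed
    have ny: "w = g y \<or> w = x" if "(y, w) \<in> parcs G" for w
    proof -
      have "g x = g w" if "w \<noteq> g y"
        using sq[OF yV \<open>(y, w) \<in> parcs G\<close> that, of "g x"] gxgy adj_sym y(2) by blast
      then show ?thesis using inv[of w] inv[OF x] in_arcsD2[OF that] by metis
    qed
    have ngx: "w = x \<or> w = g y" if "(g x, w) \<in> parcs G" for w
      using sq[OF x y that] gyx by blast
    have ngy: "w = y \<or> w = g x" if "(g y, w) \<in> parcs G" for w
      using sq[OF yV _ gyx[symmetric] that] adj_sym y(1) by blast
    let ?S = "{x, y, g y, g x}"
    have closed: "\<not> (\<exists>u\<in>?S. \<exists>v\<in>pverts G - ?S. (u, v) \<in> parcs G)"
      using nx ny ngx ngy by blast
    have "?S \<subseteq> pverts G" using x yV gV by auto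
    then have S: "pverts G = ?S"
      using con closed unfolding connected_iff_cut by (metis insert_not_empty)
    have "parcs G = {(x, y), (y, x), (y, g y), (g y, y), (g y, g x), (g x, g y), (g x, x), (x, g x)}" (is "_ = ?E")
    proof
      show "?E \<subseteq> parcs G" using y gxgy arc x yV adj_sym by auto
      show "parcs G \<subseteq> ?E"
      proof
        fix e assume e: "e \<in> parcs G"
        obtain u v where uv: "e = (u, v)" by (cases e)
        then have "u \<in> ?S" using S e in_arcsD1 by blast
        then show "e \<in> ?E" using nx ny ngx ngy e uv by blast
      qed
    qed
    moreover have "distinct [x, y, g y, g x]" using xy y gyx gg ne x yV by auto
    ultimately show ?thesis using S cycle_graph_4_iff by blast
  next
    case False
    define pend where "pend = (\<lambda>x. \<forall>w. (x, w) \<in> parcs G \<longrightarrow> w = g x)"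
    have pend: "pend x \<or> pend (g x)" if "x \<in> pverts G" for x
      using False that inv[OF that] by (auto simp: pend_def)
    \<comment> \<open>\<open>B\<close> keeps one end of each matching edge, such that the other end is pendant. When both are
      pendant the choice is arbitrary, but has to be made once for the edge; hence the use of \<open>A\<close>.\<close>
    define c where "c = (\<lambda>a. if pend (g a) then a else g a)"
    define B where "B = c ` A"
    have c: "c a = a \<or> c a = g a" "pend (g (c a))" if "a \<in> A" for a
    proof -
      have "a \<in> pverts G" using that A(1) by blast
      then show "c a = a \<or> c a = g a" "pend (g (c a))"
        using pend[of a] inv[of a] by (auto simp: c_def)
    qed
    have cV: "c a \<in> pverts G" if "a \<in> A" for a using c(1)[OF that] gV[of a] that A(1) by auto
    then have BV: "B \<subseteq> pverts G" by (auto simp: B_def)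
    have gB: "g x \<in> pverts G - B" if "x \<in> B" for x
    proof -
      obtain a where a: "a \<in> A" "x = c a" using \<open>x \<in> B\<close> by (auto simp: B_def)
      have "g x \<noteq> c b" if b: "b \<in> A" for b
      proof
        assume eq: "g x = c b"
        have V: "a \<in> pverts G" "b \<in> pverts G" using a(1) b A(1) by auto
        have "g a \<notin> A" using a(1) A(2) by blast
        moreover have "b = a \<or> b = g a"
          using eq a(2) c(1)[OF a(1)] c(1)[OF b] inv[OF V(1)] inv[OF V(2)] by metis
        ultimately have "b = a" using b by blast
        then show False using eq ne[OF cV[OF a(1)]] a(2) by simp
      qed
      then show ?thesis using that BV gV by (auto simp: B_def)
    qed
    have Bg: "g x \<in> B" "pend x" if "x \<in> pverts G - B" for x
    proof -
      have "x \<in> A \<or> x \<in> g ` A" using that A(2) by auto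
      then obtain a where a: "a \<in> A" "x = a \<or> x = g a" by blast
      have "c a \<noteq> x" using that a by (auto simp: B_def)
      moreover have "a \<in> pverts G" using a(1) A(1) by blast
      ultimately have "x = g (c a)" using a(2) c(1)[OF a(1)] inv[of a] by metis
      then show "g x \<in> B" "pend x" using inv[OF cV[OF a(1)]] a(1) c(2)[OF a(1)] by (auto simp: B_def)
    qed
    have p: "(x, w) \<in> parcs G \<longleftrightarrow> w = g x" if "x \<in> pverts G - B" for x w
      using Bg[OF that] arc that by (auto simp: pend_def)
    have gB': "g ` (pverts G - B) \<subseteq> B" using Bg by blast
    have "B \<noteq> {}" using two gB' by (metis Diff_empty card.empty image_is_empty not_numeral_le_zero subset_empty)
    then have "Digraph_Component.connected (with_proj (induced G B))"
      using connected_remove_pendants[OF con BV _ _ gB'] p by blast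
    moreover have "leaf_attachment (induced G B) (\<lambda>_. 1) G"
      unfolding leaf_attachment_def
    proof (intro exI conjI ballI)
      show "G = attach_leaves (induced G B) (pverts G - B) g"
        by (rule attach_leaves_induced[OF BV p gB'])
      fix v assume "v \<in> pverts (induced G B)"
      then have v: "v \<in> B" by simp
      then have "{x \<in> pverts G - B. g x = v} = {g v}"
        using gB BV inv by auto
      then show "card {x \<in> pverts G - B. g x = v} = 1" by simp
    qed (use gB' pair_finite_verts in auto)
    ultimately show ?thesis using pair_graph_induced[OF BV] by blast
  qed
qed

section \<open>Attaching leaves\<close>

text \<open>
  In the facts below, the vertices of \<open>H\<close> are the old ones, and those in \<open>L\<close> the new leaves. This
  describes \<open>leaf_attachment\<close> with explicit leaves.
\<close>

locale leaf_addition = pair_graph H for H :: "'a pair_pre_digraph" +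
  fixes L :: "'a set" and p :: "'a \<Rightarrow> 'a"
  assumes finite_L: "finite L" and L_fresh: "L \<inter> pverts H = {}" and p_L: "p ` L \<subseteq> pverts H"
begin

abbreviation G where "G \<equiv> attach_leaves H L p"

abbreviation leaves_at where "leaves_at v \<equiv> {x \<in> L. p x = v}"

lemma p_mem: "x \<in> L \<Longrightarrow> p x \<in> pverts H"
  using p_L by blast

lemma fresh: "x \<in> L \<Longrightarrow> x \<notin> pverts H"
  using L_fresh by blast

lemma pverts_G: "pverts G = pverts H \<union> L"
  by (simp add: attach_leaves_def)

lemma parcs_G: "(u, v) \<in> parcs G \<longleftrightarrow> (u, v) \<in> parcs H \<or> u \<in> L \<and> v = p u \<or> v \<in> L \<and> u = p v"
  by (auto simp: attach_leaves_def)

sublocale G: pair_graph "attach_leaves H L p"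
proof (rule pair_graphI)
  show "finite (pverts G)" using finite_L pair_finite_verts by (simp add: pverts_G)
  show "u \<in> pverts G \<and> u \<noteq> v \<and> (v, u) \<in> parcs G" if "(u, v) \<in> parcs G" for u v
  proof -
    consider "(u, v) \<in> parcs H" | "u \<in> L" "v = p u" | "v \<in> L" "u = p v" using \<open>(u, v) \<in> parcs G\<close> parcs_G by blast
    then show ?thesis
    proof cases
      case 1
      then show ?thesis using in_arcsD1 in_arcsD2 no_loops' arcs_symmetric by (simp add: parcs_G pverts_G)
    next
      case 2
      then show ?thesis using p_mem[of u] fresh[of u] by (auto simp: parcs_G pverts_G)
    next
      case 3
      then show ?thesis using p_mem[of v] fresh[of v] by (auto simp: parcs_G pverts_G)
    qed
  qed
qed

lemma nbrs_leaf: "x \<in> L \<Longrightarrow> {w. (x, w) \<in> parcs G} = {p x}"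
  using L_fresh p_L in_arcsD1 by (auto simp: parcs_G)

lemma nbrs_old: "v \<in> pverts H \<Longrightarrow> {w. (v, w) \<in> parcs G} = {w. (v, w) \<in> parcs H} \<union> leaves_at v"
  using L_fresh by (auto simp: parcs_G)

lemma degree_old:
  assumes "v \<in> pverts H"
  shows "card {w. (v, w) \<in> parcs G} = card {w. (v, w) \<in> parcs H} + card (leaves_at v)"
  unfolding nbrs_old[OF assms] using L_fresh in_arcsD2 finite_L
  by (intro card_Un_disjoint) auto

lemma leaves_G:
  assumes "\<And>v. v \<in> pverts H \<Longrightarrow> card {w. (v, w) \<in> parcs H} + card (leaves_at v) \<noteq> 1"
  shows "leaves G = L"
  using assms unfolding leaves_def G.out_degree_eq pverts_G
  by (auto simp: nbrs_leaf degree_old)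

lemma card_pverts_G: "card (pverts G) = card (pverts H) + card L"
  unfolding pverts_G using L_fresh finite_L pair_finite_verts by (intro card_Un_disjoint) auto

text \<open>
  In all three families the attached leaves turn out to be the only leaves, and then $n-\ell$ is
  the order of \<open>H\<close>.
\<close>

lemma isolation_number_half_iff:
  assumes "leaves G = L"
  shows "real (isolation_number k G) = (real (card (pverts G)) - real (card (leaves G))) / 2 \<longleftrightarrow>
    2 * isolation_number k G = card (pverts H)"
proof -
  have "real (card (pverts G)) - real (card (leaves G)) = real (card (pverts H))"
    using assms card_pverts_G by simp
  moreover have "real i = real c / 2 \<longleftrightarrow> 2 * i = c" for i c :: nat by linarith
  ultimately show ?thesis by simp
qed

lemma closed_nbhd_old:
  assumes "D \<subseteq> pverts H" "v \<in> pverts H"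
  shows "v \<in> closed_nbhd G D \<longleftrightarrow> v \<in> closed_nbhd H D"
  using assms L_fresh by (auto simp: closed_nbhd_def parcs_G)

text \<open>
  An undominated old vertex is harmless if it is light, that is, carries fewer than \<open>k\<close> new leaves, and
  if no other undominated old vertex is adjacent to it. A leaf at it has it as its
  only neighbour; if there is such a leaf, lightness forces \<open>k \<ge> 2\<close>, so that degree 1 is harmless.
\<close>

lemma isolating_setI:
  assumes k: "k \<ge> 1" and D: "D \<subseteq> pverts H"
    and light: "\<And>u. u \<in> pverts H - closed_nbhd H D \<Longrightarrow> card (leaves_at u) < k"
    and indep: "\<And>u w. u \<in> pverts H - closed_nbhd H D \<Longrightarrow> (u, w) \<in> parcs H \<Longrightarrow> w \<in> closed_nbhd H D"
  shows "isolating_set k G D"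
  unfolding G.isolating_set_iff
proof (intro conjI ballI)
  show "D \<subseteq> pverts G" using D by (auto simp: pverts_G)
  fix v assume v: "v \<in> pverts G - closed_nbhd G D"
  let ?N = "{w \<in> pverts G - closed_nbhd G D. (v, w) \<in> parcs G}"
  show "card ?N < k"
  proof (cases "v \<in> L")
    case True
    then have sub: "?N \<subseteq> {p v}" using nbrs_leaf by blast
    show ?thesis
    proof (cases "p v \<in> closed_nbhd G D")
      case True
      then have "?N = {}" using sub by auto
      then have "card ?N = 0" by (metis card.empty)
      then show ?thesis using k by linarith
    next
      case False
      have pv: "p v \<in> pverts H" using \<open>v \<in> L\<close> p_L by auto
      have "card ?N \<le> card {p v}" using sub by (intro card_mono) auto
      also have "\<dots> = card {v}" by simp
      also have "\<dots> \<le> card (leaves_at (p v))" using finite_L True by (intro card_mono) auto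
      also have "\<dots> < k" using light pv False closed_nbhd_old[OF D pv] by auto
      finally show ?thesis .
    qed
  next
    case False
    then have vH: "v \<in> pverts H" using v pverts_G by auto
    then have vu: "v \<in> pverts H - closed_nbhd H D" using v closed_nbhd_old[OF D] by auto
    have "?N \<subseteq> leaves_at v"
    proof
      fix w assume w: "w \<in> ?N"
      then have "(v, w) \<in> parcs H \<or> w \<in> leaves_at v" using nbrs_old[OF vH] by blast
      moreover have "(v, w) \<notin> parcs H"
        using indep[OF vu, of w] in_arcsD2[of v w] closed_nbhd_old[OF D, of w] w by auto
      ultimately show "w \<in> leaves_at v" by blast
    qed
    then have "card ?N \<le> card (leaves_at v)" using finite_L by (intro card_mono) auto
    then show ?thesis using light[OF vu] by simp
  qed
qed

lemma dominating_set_isolating: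
  assumes "k \<ge> 1" "dominating_set H D"
  shows "isolating_set k G D"
  using assms by (intro isolating_setI) (auto simp: dominating_set_def)

lemma isolation_number_upper:
  assumes "k \<ge> 1" "\<And>v. v \<in> pverts H \<Longrightarrow> \<exists>w. (v, w) \<in> parcs H"
  shows "2 * isolation_number k G \<le> card (pverts H)"
proof -
  obtain D where "dominating_set H D" "2 * card D \<le> card (pverts H)" using ore_domination_bound[OF assms(2)] by blast
  then show ?thesis using isolation_number_le[OF dominating_set_isolating[OF assms(1)]] by fastforce
qed

text \<open>
  The closed neighbourhood of a heavy vertex, one with at least \<open>k\<close> new leaves, meets every
  isolating set: otherwise the vertex itself survives, and so do all the leaves at it, whose only
  neighbour it is.
\<close>

lemma isolating_set_meets:
  assumes D: "isolating_set k G D" and v: "v \<in> pverts H" "k \<le> card (leaves_at v)"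
  shows "\<exists>d\<in>D. d = v \<or> (v, d) \<in> parcs H \<or> d \<in> leaves_at v"
proof (rule ccontr)
  assume "\<not> ?thesis"
  then have no: "d \<noteq> v" "(v, d) \<notin> parcs G" if "d \<in> D" for d using that nbrs_old[OF v(1)] by auto
  then have vN: "v \<in> pverts G - closed_nbhd G D"
    using v G.adj_sym by (auto simp: pverts_G closed_nbhd_def)
  have "x \<notin> closed_nbhd G D" if "x \<in> leaves_at v" for x
  proof -
    have "(x, u) \<in> parcs G \<longleftrightarrow> u = v" for u using nbrs_leaf[of x] that by auto
    then have "(v, x) \<in> parcs G" "(u, x) \<in> parcs G \<longleftrightarrow> u = v" for u using G.adj_sym by auto
    then show ?thesis using no by (auto simp: closed_nbhd_def)
  qed
  moreover have "leaves_at v \<subseteq> {w. (v, w) \<in> parcs G}" using nbrs_old[OF v(1)] by blast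
  ultimately have "leaves_at v \<subseteq> {w \<in> pverts G - closed_nbhd G D. (v, w) \<in> parcs G}"
    by (auto simp: pverts_G)
  then have "card (leaves_at v) \<le> card {w \<in> pverts G - closed_nbhd G D. (v, w) \<in> parcs G}"
    using G.pair_finite_verts by (intro card_mono) auto
  moreover have "card {w \<in> pverts G - closed_nbhd G D. (v, w) \<in> parcs G} < k"
    using D vN unfolding G.isolating_set_iff by (elim conjE bspec)
  ultimately show False using v(2) by linarith
qed

text \<open>
  When every old vertex receives exactly one leaf, \<open>p\<close> is a perfect matching between the new and
  the old vertices.
\<close>

lemma corona_bij:
  assumes "\<And>v. v \<in> pverts H \<Longrightarrow> card (leaves_at v) = 1"
  shows "bij_betw p L (pverts H)"
proof (rule bij_betw_imageI)
  show "inj_on p L"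
  proof (rule inj_onI)
    fix x y assume xy: "x \<in> L" "y \<in> L" "p x = p y"
    obtain z where "leaves_at (p x) = {z}"
      using assms[of "p x"] xy p_mem by (metis (no_types, lifting) card_1_singletonE)
    moreover have "x \<in> leaves_at (p x)" "y \<in> leaves_at (p x)" using xy by auto
    ultimately have "x \<in> {z}" "y \<in> {z}" by (metis (lifting))+
    then show "x = y" by simp
  qed
  have "v \<in> p ` L" if "v \<in> pverts H" for v
  proof -
    have "leaves_at v \<noteq> {}" using assms[OF that] by (metis card.empty zero_neq_one)
    then show ?thesis by blast
  qed
  then show "p ` L = pverts H" using p_L by blast
qed

end

lemma leaf_attachmentE:
  assumes "leaf_attachment H f G" "pair_graph H"
  obtains L p where "leaf_addition H L p" "G = attach_leaves H L p"
    "\<And>v. v \<in> pverts H \<Longrightarrow> card {x \<in> L. p x = v} = f v"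
  using assms unfolding leaf_attachment_def leaf_addition_def leaf_addition_axioms_def by blast

lemma (in leaf_addition) leaf_attachment_G:
  "leaf_attachment H (\<lambda>v. card (leaves_at v)) G"
  unfolding leaf_attachment_def using finite_L L_fresh p_L by blast

text \<open>
  The neighbour of a leaf is not a leaf, as the two would form a component. So \<open>G\<close>
  is recovered from its non-leaves by attaching its leaves.
\<close>

lemma (in pair_graph) connected_minus_leaves:
  assumes con: "Digraph_Component.connected (with_proj G)" and three: "card (pverts G) \<ge> 3"
  obtains H p where "leaf_addition H (leaves G) p" "G = attach_leaves H (leaves G) p"
    "Digraph_Component.connected (with_proj H)"
proof -
  define C where "C = pverts G - leaves G"
  have leaf: "x \<in> leaves G \<longleftrightarrow> x \<in> pverts G \<and> (\<exists>y. {w. (x, w) \<in> parcs G} = {y})" for x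
    by (auto simp: leaves_def out_degree_eq card_1_singleton_iff)
  have L: "leaves G = pverts G - C" "leaves G \<subseteq> pverts G" and C: "C \<subseteq> pverts G" by (auto simp: C_def leaves_def)
  obtain p where p: "{w. (x, w) \<in> parcs G} = {p x}" if "x \<in> leaves G" for x
    using leaf by metis
  have p': "(x, w) \<in> parcs G \<longleftrightarrow> w = p x" if "x \<in> pverts G - C" for x w
    using p[of x] that L by blast
  have "p x \<in> C" if x: "x \<in> leaves G" for x
  proof (rule ccontr)
    assume "p x \<notin> C"
    have xp: "(x, p x) \<in> parcs G" using p[OF x] by blast
    then have px: "p x \<in> pverts G" "p x \<in> leaves G" using in_arcsD2 \<open>p x \<notin> C\<close> C_def by auto
    have "x \<in> {w. (p x, w) \<in> parcs G}" using xp adj_sym by blast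
    then have "p (p x) = x" unfolding p[OF px(2)] by simp
    then have closed: "\<not> (\<exists>u\<in>{x, p x}. \<exists>v\<in>pverts G - {x, p x}. (u, v) \<in> parcs G)"
      using p[OF x] p[OF px(2)] by auto
    have "{x, p x} \<subseteq> pverts G" using px x L by auto
    then have "pverts G = {x, p x}" using con closed unfolding connected_iff_cut by (metis insert_not_empty)
    then have "card (pverts G) \<le> 2" by (simp add: card_insert_if)
    then show False using three by simp
  qed
  then have pC: "p ` (pverts G - C) \<subseteq> C" using L by auto
  have "pverts G \<noteq> {}" using three by auto
  then have "C \<noteq> {}" using pC by auto
  then have "Digraph_Component.connected (with_proj (induced G C))"
    using connected_remove_pendants[OF con C _ _ pC] p' by blast
  moreover have "G = attach_leaves (induced G C) (leaves G) p"
    unfolding L(1) by (rule attach_leaves_induced[OF C p' pC])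
  moreover have "leaf_addition (induced G C) (leaves G) p"
    using pair_graph_induced[OF C] pC L pair_finite_verts finite_subset[OF L(2)]
    by (auto simp: leaf_addition_def leaf_addition_axioms_def)
  ultimately show thesis using that by blast
qed

section \<open>The extremal attachments\<close>

lemma (in pair_graph) complete_digraph_2I:
  assumes two: "card (pverts G) = 2" and no_isolated: "\<And>v. v \<in> pverts G \<Longrightarrow> \<exists>w. (v, w) \<in> parcs G"
  shows "complete_digraph 2 (with_proj G)"
proof -
  obtain a b where V: "pverts G = {a, b}" using two by (meson card_2_iff)
  have other: "(u, v) \<in> parcs G" if uv: "u \<in> pverts G" "v \<in> pverts G" "u \<noteq> v" for u v
  proof -
    obtain w where w: "(u, w) \<in> parcs G" using no_isolated uv(1) by blast
    then have "w \<in> pverts G" "w \<noteq> u" using in_arcsD2 no_loops' by blast+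
    then have "w = v" using uv V by auto
    then show ?thesis using w by simp
  qed
  then have "parcs G = {(u, v). (u, v) \<in> pverts G \<times> pverts G \<and> u \<noteq> v}"
  proof (intro set_eqI iffI)
    fix e assume "e \<in> parcs G"
    then show "e \<in> {(u, v). (u, v) \<in> pverts G \<times> pverts G \<and> u \<noteq> v}"
      using in_arcsD1 in_arcsD2 no_loops' by (cases e) blast
  next
    fix e assume "e \<in> {(u, v). (u, v) \<in> pverts G \<times> pverts G \<and> u \<noteq> v}"
    then show "e \<in> parcs G" using other by auto
  qed
  then show ?thesis unfolding complete_digraph_pair_def using two pair_finite_verts by blast
qed

lemma complete_digraph_2_degree:
  assumes "complete_digraph 2 (with_proj H)" "v \<in> pverts H"
  shows "card {w. (v, w) \<in> parcs H} = 1"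
proof -
  have H: "finite (pverts H)" "card (pverts H) = 2" "parcs H = {(u, v). (u, v) \<in> pverts H \<times> pverts H \<and> u \<noteq> v}"
    using assms(1) unfolding complete_digraph_pair_def by auto
  have "{w. (v, w) \<in> parcs H} = pverts H - {v}" using assms(2) by (auto simp: H(3))
  then show ?thesis using H(1,2) assms(2) by simp
qed

lemma pair_graph_cycle_graph_4:
  assumes "cycle_graph 4 H" shows "pair_graph H"
proof -
  obtain a b c d where H: "distinct [a, b, c, d]" "pverts H = {a, b, c, d}"
    "parcs H = {(a, b), (b, a), (b, c), (c, b), (c, d), (d, c), (d, a), (a, d)}"
    using iffD1[OF cycle_graph_4_iff assms] by (elim exE conjE) (rule that)
  then show ?thesis by (intro pair_graphI) auto
qed

lemma cycle_graph_4_degree: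
  assumes "cycle_graph 4 H" "v \<in> pverts H"
  shows "card {w. (v, w) \<in> parcs H} = 2"
proof -
  obtain a b c d where H: "distinct [a, b, c, d]" "pverts H = {a, b, c, d}"
    "parcs H = {(a, b), (b, a), (b, c), (c, b), (c, d), (d, c), (d, a), (a, d)}"
    using iffD1[OF cycle_graph_4_iff assms(1)] by (elim exE conjE) (rule that)
  have "{w. (a, w) \<in> parcs H} = {b, d}" "{w. (b, w) \<in> parcs H} = {a, c}"
    "{w. (c, w) \<in> parcs H} = {b, d}" "{w. (d, w) \<in> parcs H} = {a, c}"
    using H(1) unfolding H(3) by auto
  then show ?thesis using assms(2) H(1) unfolding H(2) by auto
qed

context leaf_addition
begin

lemma isolation_number_pos:
  assumes v: "v \<in> pverts G" "k \<le> card {w. (v, w) \<in> parcs G}"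
  shows "isolation_number k G \<ge> 1"
proof -
  obtain D where D: "isolating_set k G D" "card D = isolation_number k G"
    using G.isolation_number_attained by blast
  have "D \<noteq> {}"
  proof
    assume "D = {}"
    then have "card {w \<in> pverts G. (v, w) \<in> parcs G} < k"
      using D(1) v(1) unfolding G.isolating_set_iff by simp
    moreover have "{w \<in> pverts G. (v, w) \<in> parcs G} = {w. (v, w) \<in> parcs G}" using G.in_arcsD2 by blast
    ultimately show False using v(2) by simp
  qed
  moreover have "finite D" using D(1) G.pair_finite_verts finite_subset
    unfolding G.isolating_set_iff by blast
  ultimately show ?thesis using D(2) by (metis One_nat_def Suc_leI card_gt_0_iff)
qed

text \<open>
  Equality means that the isolation number is 1, hence that the empty set is not isolating, hence
  that some degree is at least \<open>k\<close>. The degree of an old vertex exceeds the number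
  of its leaves by one. A new leaf can only have degree at least \<open>k\<close> when \<open>k = 1\<close>, and then every old
  vertex has at least \<open>k - 1\<close> leaves.
\<close>

lemma extremal_K2_iff:
  assumes k: "k \<ge> 1" and K2: "complete_digraph 2 (with_proj H)"
  shows "2 * isolation_number k G = card (pverts H) \<longleftrightarrow> (\<exists>v\<in>pverts H. k - 1 \<le> card (leaves_at v))"
proof -
  have two: "card (pverts H) = 2" using K2 by (simp add: complete_digraph_pair_def)
  have deg: "card {w. (v, w) \<in> parcs G} = 1 + card (leaves_at v)" if "v \<in> pverts H" for v
    using degree_old[OF that] complete_digraph_2_degree[OF K2 that] by simp
  have "\<exists>w. (v, w) \<in> parcs H" if "v \<in> pverts H" for v
    using complete_digraph_2_degree[OF K2 that] by (auto simp: card_1_singleton_iff)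
  then have upper: "2 * isolation_number k G \<le> 2" using isolation_number_upper[OF k] two by metis
  show ?thesis
  proof
    assume eq: "2 * isolation_number k G = card (pverts H)"
    have "\<not> isolating_set k G {}"
      using isolation_number_le[of k G "{}"] eq two by auto
    then obtain v where v: "v \<in> pverts G" "k \<le> card {w \<in> pverts G. (v, w) \<in> parcs G}"
      unfolding G.isolating_set_iff by (auto simp: not_less)
    have "{w \<in> pverts G. (v, w) \<in> parcs G} = {w. (v, w) \<in> parcs G}" using G.in_arcsD2 by blast
    then have v2: "k \<le> card {w. (v, w) \<in> parcs G}" using v(2) by simp
    show "\<exists>v\<in>pverts H. k - 1 \<le> card (leaves_at v)"
    proof (cases "v \<in> L")
      case True
      then have "k \<le> 1" using v2 nbrs_leaf[of v] by simp
      then have "k - 1 \<le> card (leaves_at (p v))" by linarith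
      then show ?thesis using p_mem[OF True] by blast
    next
      case False
      then have "v \<in> pverts H" using v(1) pverts_G by auto
      then have "v \<in> pverts H \<and> k - 1 \<le> card (leaves_at v)" using v2 deg[of v] by linarith
      then show ?thesis by blast
    qed
  next
    assume "\<exists>v\<in>pverts H. k - 1 \<le> card (leaves_at v)"
    then obtain v where v: "v \<in> pverts H" "k - 1 \<le> card (leaves_at v)" by blast
    have "isolation_number k G \<ge> 1"
      using deg[OF v(1)] v k by (intro isolation_number_pos[of v]) (auto simp: pverts_G)
    then show "2 * isolation_number k G = card (pverts H)" using upper two by simp
  qed
qed

text \<open>
  If a vertex of the cycle is light, then the opposite vertex alone is isolating. If all are heavy,
  then every isolating set meets their four closed neighbourhoods, and no single vertex lies in
  all of these.
\<close>

lemma extremal_C4_iff: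
  assumes k: "k \<ge> 1" and C4: "cycle_graph 4 H"
  shows "2 * isolation_number k G = card (pverts H) \<longleftrightarrow> (\<forall>v\<in>pverts H. k \<le> card (leaves_at v))"
proof -
  obtain a b c d where H: "distinct [a, b, c, d]" "pverts H = {a, b, c, d}"
    "parcs H = {(a, b), (b, a), (b, c), (c, b), (c, d), (d, c), (d, a), (a, d)}"
    using iffD1[OF cycle_graph_4_iff C4] by (elim exE conjE) (rule that)
  have four: "card (pverts H) = 4" using H(1,2) by simp
  show ?thesis
  proof
    assume eq: "2 * isolation_number k G = card (pverts H)"
    have heavy: "k \<le> card (leaves_at a)"
      if H: "distinct [a, b, c, d]" "pverts H = {a, b, c, d}"
        "parcs H = {(a, b), (b, a), (b, c), (c, b), (c, d), (d, c), (d, a), (a, d)}" for a b c d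
    proof (rule ccontr)
      assume light: "\<not> k \<le> card (leaves_at a)"
      have N: "closed_nbhd H {c} = {b, c, d}" using H(1) by (auto simp: closed_nbhd_def H(3))
      have "isolating_set k G {c}"
      proof (rule isolating_setI[OF k])
        show "{c} \<subseteq> pverts H" by (simp add: H(2))
        fix u assume "u \<in> pverts H - closed_nbhd H {c}"
        then have u: "u = a" unfolding N H(2) by auto
        then show "card (leaves_at u) < k" using light by simp
        show "w \<in> closed_nbhd H {c}" if "(u, w) \<in> parcs H" for w
          using that u H(1) unfolding N H(3) by auto
      qed
      then show False using isolation_number_le[of k G "{c}"] eq four by simp
    qed
    have "k \<le> card (leaves_at a)" by (rule heavy[OF H])
    moreover have "k \<le> card (leaves_at b)" by (rule heavy[of b c d a]) (use H in auto)
    moreover have "k \<le> card (leaves_at c)" by (rule heavy[of c d a b]) (use H in auto)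
    moreover have "k \<le> card (leaves_at d)" by (rule heavy[of d a b c]) (use H in auto)
    ultimately show "\<forall>v\<in>pverts H. k \<le> card (leaves_at v)" by (simp add: H(2))
  next
    assume heavy: "\<forall>v\<in>pverts H. k \<le> card (leaves_at v)"
    have "2 * isolation_number k G \<le> card (pverts H)"
      by (rule isolation_number_upper[OF k]) (auto simp: H(2,3))
    moreover obtain D where D: "isolating_set k G D" "card D = isolation_number k G"
      using G.isolation_number_attained by blast
    have fin: "finite D" using D(1) G.pair_finite_verts finite_subset
      unfolding G.isolating_set_iff by blast
    have "2 \<le> card D"
    proof (rule ccontr)
      assume "\<not> 2 \<le> card D"
      then have unique: "x = y" if "x \<in> D" "y \<in> D" for x y
        using card_le_Suc0_iff_eq[OF fin] that by simp
      have meet: "\<exists>d\<in>D. d = v \<or> (v, d) \<in> parcs H \<or> d \<in> leaves_at v" if "v \<in> pverts H" for v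
        using isolating_set_meets[OF D(1) that] heavy that by blast
      obtain e where "e \<in> D" using meet[of a] H(2) by blast
      then have e: "e = v \<or> (v, e) \<in> parcs H \<or> e \<in> leaves_at v" if "v \<in> pverts H" for v
        using meet[OF that] unique by blast
      have all: "e = a \<or> e = b \<or> e = d \<or> e \<in> leaves_at a" "e = b \<or> e = a \<or> e = c \<or> e \<in> leaves_at b"
        "e = c \<or> e = b \<or> e = d \<or> e \<in> leaves_at c" "e = d \<or> e = a \<or> e = c \<or> e \<in> leaves_at d"
        using e[of a] e[of b] e[of c] e[of d] H(1) unfolding H(2,3) by auto
      have "e \<notin> {a, b, c, d}" if "e \<in> L" using fresh[OF that] H(2) by simp
      then show False using all H(1) by auto
    qed
    ultimately show "2 * isolation_number k G = card (pverts H)" using D(2) four by simp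
  qed
qed

end

section \<open>Coronas with attached leaves\<close>

text \<open>
  Excluding isolated vertices of \<open>H\<close> rules out components $K_2$ of the corona, both ends of which
  would be leaves, and makes the attached vertices the only leaves.
\<close>

locale corona = leaf_addition +
  assumes one_leaf_each: "\<And>v. v \<in> pverts H \<Longrightarrow> card (leaves_at v) = 1"
    and no_isolated: "\<And>v. v \<in> pverts H \<Longrightarrow> \<exists>w. (v, w) \<in> parcs H"
begin

lemma leaves_corona: "leaves G = L"
proof (rule leaves_G)
  fix v assume v: "v \<in> pverts H"
  then have "{w. (v, w) \<in> parcs H} \<noteq> {}" using no_isolated by auto
  then have "card {w. (v, w) \<in> parcs H} > 0" by (simp add: card_gt_0_iff)
  then show "card {w. (v, w) \<in> parcs H} + card (leaves_at v) \<noteq> 1"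
    using one_leaf_each[OF v] by linarith
qed

lemma corona_card: "card L = card (pverts H)" "card (pverts G) = 2 * card (pverts H)"
  using bij_betw_same_card[OF corona_bij[OF one_leaf_each]] card_pverts_G by simp_all

text \<open>
  If a leaf \<open>y\<close> of the corona is light, then the vertices of \<open>H\<close> other than the neighbour of \<open>y\<close> are
  isolating: since \<open>H\<close> has no isolated vertices, they dominate all but \<open>y\<close>. If all leaves of the corona
  are heavy, then every isolating set meets the closed neighbourhoods of these leaves, which are
  disjoint.
\<close>

lemma extremal_corona_iff:
  assumes k: "k \<ge> 1" and ext: "leaf_addition G M q"
  shows "2 * isolation_number k (attach_leaves G M q) = card (pverts G) \<longleftrightarrow>
    (\<forall>v\<in>L. k \<le> card {x \<in> M. q x = v})"
proof -
  interpret E: leaf_addition G M q by (rule ext)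
  have inj: "inj_on p L" using corona_bij[OF one_leaf_each] by (rule bij_betw_imp_inj_on)
  show ?thesis
  proof
    assume eq: "2 * isolation_number k E.G = card (pverts G)"
    show "\<forall>v\<in>L. k \<le> card {x \<in> M. q x = v}"
    proof (intro ballI, rule ccontr)
      fix y assume y: "y \<in> L" and light: "\<not> k \<le> card {x \<in> M. q x = y}"
      let ?D = "pverts H - {p y}"
      have D: "?D \<subseteq> pverts G" by (auto simp: pverts_G)
      obtain w where "(p y, w) \<in> parcs H" using no_isolated p_mem[OF y] by blast
      then have "(w, p y) \<in> parcs G" "w \<in> ?D" using in_arcsD2 no_loops' adj_sym by (auto simp: parcs_G)
      then have py: "p y \<in> closed_nbhd G ?D" by (auto simp: closed_nbhd_def)
      have undom: "u = y" if u: "u \<in> pverts G - closed_nbhd G ?D" for u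
      proof -
        have "u \<notin> pverts H" using u py subset_closed_nbhd[of ?D G] by auto
        then have uL: "u \<in> L" using u by (auto simp: pverts_G)
        have "p u \<notin> ?D" using u uL by (auto simp: closed_nbhd_def parcs_G)
        then have "p u = p y" using p_mem[OF uL] by auto
        then show "u = y" using inj uL y by (auto simp: inj_on_def)
      qed
      have "isolating_set k E.G ?D"
      proof (rule E.isolating_setI[OF k D])
        fix u assume "u \<in> pverts G - closed_nbhd G ?D"
        then have u: "u = y" by (rule undom)
        then show "card {x \<in> M. q x = u} < k" using light by simp
        show "w \<in> closed_nbhd G ?D" if "(u, w) \<in> parcs G" for w
        proof -
          have "w \<in> {w. (y, w) \<in> parcs G}" using that u by simp
          then show ?thesis using py unfolding nbrs_leaf[OF y] by simp
        qed
      qed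
      then have "isolation_number k E.G \<le> card (pverts H) - 1"
        using isolation_number_le[of k E.G ?D] p_mem[OF y] by simp
      moreover have "card (pverts H) > 0" using p_mem[OF y] pair_finite_verts by (auto simp: card_gt_0_iff)
      ultimately show False using eq corona_card(2) by simp
    qed
  next
    assume heavy: "\<forall>v\<in>L. k \<le> card {x \<in> M. q x = v}"
    have "\<exists>w. (v, w) \<in> parcs G" if "v \<in> pverts G" for v
      using that no_isolated by (auto simp: pverts_G parcs_G)
    then have upper: "2 * isolation_number k E.G \<le> card (pverts G)"
      by (rule E.isolation_number_upper[OF k])
    obtain D where D: "isolating_set k E.G D" "card D = isolation_number k E.G"
      using E.G.isolation_number_attained by blast
    have fin: "finite D" using D(1) E.G.pair_finite_verts finite_subset
      unfolding E.G.isolating_set_iff by blast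
    have "\<exists>d\<in>D. d = y \<or> d = p y \<or> d \<in> E.leaves_at y" if y: "y \<in> L" for y
    proof -
      have "\<exists>d\<in>D. d = y \<or> (y, d) \<in> parcs G \<or> d \<in> E.leaves_at y"
        by (rule E.isolating_set_meets[OF D(1)]) (use y heavy in \<open>auto simp: pverts_G\<close>)
      then show ?thesis using nbrs_leaf[OF y] by auto
    qed
    then obtain e where e: "e y \<in> D" "e y = y \<or> e y = p y \<or> e y \<in> E.leaves_at y" if "y \<in> L" for y
      by metis
    \<comment> \<open>The set is met in \<open>e y\<close> near the leaf \<open>y\<close>; injectivity is disjointness.\<close>
    have "inj_on e L"
    proof (rule inj_onI)
      fix y z assume yz: "y \<in> L" "z \<in> L" "e y = e z"
      have "y \<notin> M" "z \<notin> M" "p y \<notin> M" "p z \<notin> M"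
        using E.fresh yz p_mem by (auto simp: pverts_G)
      moreover have "p y \<noteq> z" "p z \<noteq> y" using p_mem fresh yz by metis+
      ultimately show "y = z" using e(2)[OF yz(1)] e(2)[OF yz(2)] yz inj by (auto simp: inj_on_def)
    qed
    then have "card L \<le> card D" using card_inj_on_le[of e L D] e(1) fin by blast
    then show "2 * isolation_number k E.G = card (pverts G)"
      using upper D(2) corona_card by simp
  qed
qed

end

section \<open>The extremal graphs for the isolation number\<close>

theorem theorem2p2:
  fixes G :: "'a pair_pre_digraph" and k n l :: nat
  assumes "k \<ge> 1"
    and "pair_graph G"
    and "Digraph_Component.connected (with_proj G)"
    and "card (pverts G) = n"
    and "n \<ge> 3"
    and "card (leaves G) = l"
  shows "real (isolation_number k G) = (real n - real l) / 2 \<longleftrightarrow>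
      (\<exists>H f. complete_digraph 2 (with_proj H) \<and> leaf_attachment H f G
         \<and> (\<forall>v\<in>pverts H. f v > 0) \<and> (\<exists>v\<in>pverts H. f v \<ge> k - 1))
    \<or> (\<exists>H f. cycle_graph 4 H \<and> leaf_attachment H f G \<and> (\<forall>v\<in>pverts H. f v \<ge> k))
    \<or> (\<exists>G' f. G' \<in> K1_coronas \<and> leaf_attachment G' f G \<and> (\<forall>v\<in>leaves G'. f v \<ge> k))"
    (is "?L \<longleftrightarrow> ?a \<or> ?b \<or> ?c")
proof
  note k = \<open>k \<ge> 1\<close>
  interpret G: pair_graph G by fact
  have "card (pverts G) \<ge> 3" using assms by simp
  then obtain H L p where L: "leaves G = L" and "leaf_addition H L p" and G: "G = attach_leaves H L p"
    and con: "Digraph_Component.connected (with_proj H)"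
    using G.connected_minus_leaves[OF assms(3)] by metis
  interpret H: leaf_addition H L p by fact
  let ?f = "\<lambda>v. card {x \<in> L. p x = v}"
  have att: "leaf_attachment H ?f G" using H.leaf_attachment_G G by simp
  assume ?L
  then have eq: "2 * isolation_number k G = card (pverts H)"
    using H.isolation_number_half_iff[folded G, OF L] assms(4,6) by simp
  have "card (pverts H) > 0"
    using con H.connected_iff_cut H.pair_finite_verts by (simp add: card_gt_0_iff)
  then have two: "card (pverts H) \<ge> 2" using eq by (cases "isolation_number k G") auto
  have no_isolated: "\<exists>w. (v, w) \<in> parcs H" if "v \<in> pverts H" for v
    using H.connected_imp_no_isolated[OF con two that] by blast
  have "card (pverts H) \<le> 2 * card D" if "dominating_set H D" for D
    using isolation_number_le[OF H.dominating_set_isolating[OF k that]] eq G by simp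
  then consider (C4) "cycle_graph 4 H"
    | (corona) H0 where "pair_graph H0" "Digraph_Component.connected (with_proj H0)"
        "leaf_attachment H0 (\<lambda>_. 1) H"
    using H.payan_xuong[OF con two] by blast
  then show "?a \<or> ?b \<or> ?c"
  proof cases
    case C4
    then have "\<forall>v\<in>pverts H. k \<le> ?f v" using H.extremal_C4_iff[OF k] eq G by simp
    then have ?b using C4 att by blast
    then show ?thesis by blast
  next
    case corona
    obtain L0 p0 where "leaf_addition H0 L0 p0" and H: "H = attach_leaves H0 L0 p0"
      and one: "\<And>v. v \<in> pverts H0 \<Longrightarrow> card {x \<in> L0. p0 x = v} = 1"
      using leaf_attachmentE[OF corona(3,1)] by metis
    interpret H0: leaf_addition H0 L0 p0 by fact
    have card_H: "card (pverts H) = 2 * card (pverts H0)"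
      using bij_betw_same_card[OF H0.corona_bij[OF one]] H0.card_pverts_G H by simp
    show ?thesis
    proof (cases "card (pverts H0) \<ge> 2")
      case True
      interpret H0: corona H0 L0 p0
        using one H0.connected_imp_no_isolated[OF corona(2) True] by unfold_locales blast+
      have "\<forall>v\<in>L0. k \<le> ?f v"
        using H0.extremal_corona_iff[OF k, of L p] H.leaf_addition_axioms eq G H
        by (metis (no_types, lifting))
      then have "\<forall>v\<in>leaves H. k \<le> ?f v" using H0.leaves_corona H by simp
      moreover have "H \<in> K1_coronas" using corona True by (auto simp: K1_coronas_def)
      ultimately have ?c using att by blast
      then show ?thesis by blast
    next
      case False
      then have "card (pverts H) = 2" using two card_H by simp
      then have K2: "complete_digraph 2 (with_proj H)" using H.complete_digraph_2I no_isolated by blast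
      have pos: "?f v > 0" if v: "v \<in> pverts H" for v
      proof -
        have "v \<notin> leaves G" "v \<in> pverts G" using v H.fresh L G H.pverts_G by auto
        then have "card {w. (v, w) \<in> parcs G} \<noteq> 1" by (auto simp: leaves_def G.out_degree_eq)
        then show ?thesis using H.degree_old[OF v] complete_digraph_2_degree[OF K2 v] G by simp
      qed
      then have "\<exists>v\<in>pverts H. k - 1 \<le> ?f v" using H.extremal_K2_iff[OF k K2] eq G by simp
      then have ?a using K2 att pos by blast
      then show ?thesis by blast
    qed
  qed
next
  note k = \<open>k \<ge> 1\<close>
  assume "?a \<or> ?b \<or> ?c"
  then consider (a) H f where "complete_digraph 2 (with_proj H)" "leaf_attachment H f G"
      "\<And>v. v \<in> pverts H \<Longrightarrow> f v > 0" "\<exists>v\<in>pverts H. f v \<ge> k - 1"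
    | (b) H f where "cycle_graph 4 H" "leaf_attachment H f G" "\<And>v. v \<in> pverts H \<Longrightarrow> f v \<ge> k"
    | (c) H f where "H \<in> K1_coronas" "leaf_attachment H f G" "\<And>v. v \<in> leaves H \<Longrightarrow> f v \<ge> k"
    by blast
  then show ?L
  proof cases
    case a
    obtain L p where "leaf_addition H L p" and G: "G = attach_leaves H L p"
      and f: "\<And>v. v \<in> pverts H \<Longrightarrow> card {x \<in> L. p x = v} = f v"
      using leaf_attachmentE[OF a(2) pair_graphI_complete[OF a(1)]] by metis
    interpret H: leaf_addition H L p by fact
    have "leaves G = L"
      unfolding G using complete_digraph_2_degree[OF a(1)] f a(3) by (intro H.leaves_G) force
    moreover have "2 * isolation_number k G = card (pverts H)"
      using H.extremal_K2_iff[OF k a(1)] f a(4) G by simp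
    ultimately show ?thesis using H.isolation_number_half_iff[folded G] assms(4,6) by simp
  next
    case b
    obtain L p where "leaf_addition H L p" and G: "G = attach_leaves H L p"
      and f: "\<And>v. v \<in> pverts H \<Longrightarrow> card {x \<in> L. p x = v} = f v"
      using leaf_attachmentE[OF b(2) pair_graph_cycle_graph_4[OF b(1)]] by metis
    interpret H: leaf_addition H L p by fact
    have "leaves G = L"
      unfolding G using cycle_graph_4_degree[OF b(1)] by (intro H.leaves_G) simp
    moreover have "2 * isolation_number k G = card (pverts H)"
      using H.extremal_C4_iff[OF k b(1)] f b(3) G by simp
    ultimately show ?thesis using H.isolation_number_half_iff[folded G] assms(4,6) by simp
  next
    case c
    then obtain H0 where H0: "pair_graph H0" "Digraph_Component.connected (with_proj H0)"
      "card (pverts H0) \<ge> 2" "leaf_attachment H0 (\<lambda>_. 1) H"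
      by (auto simp: K1_coronas_def)
    obtain L0 p0 where "leaf_addition H0 L0 p0" and H: "H = attach_leaves H0 L0 p0"
      and one: "\<And>v. v \<in> pverts H0 \<Longrightarrow> card {x \<in> L0. p0 x = v} = 1"
      using leaf_attachmentE[OF H0(4,1)] by metis
    interpret H0: leaf_addition H0 L0 p0 by fact
    interpret H0: corona H0 L0 p0
      using one H0.connected_imp_no_isolated[OF H0(2,3)] by unfold_locales blast+
    obtain L p where "leaf_addition H L p" and G: "G = attach_leaves H L p"
      and f: "\<And>v. v \<in> pverts H \<Longrightarrow> card {x \<in> L. p x = v} = f v"
      using leaf_attachmentE[OF c(2)] H0.G.pair_graph H by metis
    interpret H: leaf_addition H L p by fact
    have leaves_H: "leaves H = L0" using H0.leaves_corona H by simp
    have L0: "L0 \<subseteq> pverts H" using H0.pverts_G H by simp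
    have "leaves G = L" unfolding G
    proof (rule H.leaves_G)
      fix v assume v: "v \<in> pverts H"
      obtain w where "(v, w) \<in> parcs H"
        using H0.no_isolated v H H0.pverts_G H0.parcs_G by blast
      then have "{w. (v, w) \<in> parcs H} \<noteq> {}" by blast
      then have pos: "card {w. (v, w) \<in> parcs H} > 0" by (simp add: card_gt_0_iff)
      show "card {w. (v, w) \<in> parcs H} + card {x \<in> L. p x = v} \<noteq> 1"
      proof (cases "v \<in> leaves H")
        case True
        then have "card {x \<in> L. p x = v} \<ge> 1" using c(3) f[OF v] k by fastforce
        then show ?thesis using pos by linarith
      next
        case False
        then have "card {w. (v, w) \<in> parcs H} \<noteq> 1" using v by (simp add: leaves_def H.out_degree_eq)
        then show ?thesis using pos by linarith
      qed
    qed
    moreover have "2 * isolation_number k G = card (pverts H)"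
      using H0.extremal_corona_iff[OF k, of L p] H.leaf_addition_axioms c(3) f L0 leaves_H G H
      by (metis (no_types, lifting) subsetD)
    ultimately show ?thesis using H.isolation_number_half_iff[folded G] assms(4,6) by simp
  qed
qed

end
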